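(* Let $a\ge b>0$. A unique scaling transformation sends the circumcircle family with parameters $a,b$ to the excentral family. This is the scaling by $s'$ along the major axis of the caustic of the circumcircle family, i.e., $(x,y)\mapsto(s'x,y)$, where $$s'=\sqrt{\frac{2b^2+ab}{2a^2+ab}}.$$
   Context: Circumcircle family with parameters $a,b$: the set of all (nondegenerate) triangles inscribed in the circle of radius $R=a+b$ centered at the origin whose three sides are tangent to the concentric ellipse $x^2/a^2+y^2/b^2=1$ (the caustic). (By Poncelet's porism, with this value of $R$, every point of the circle is a vertex of exactly one such triangle.) Confocal family: for a pair consisting of an ellipse and a confocal ellipse inside it (concentric, axis-aligned, with semi-axes $\alpha,\beta$ and $\alpha_c,\beta_c$ satisfying $\alpha^2-\beta^2=\alpha_c^2-\beta_c^2$) such that triangles inscribed in the outer ellipse and circumscribed about the inner one exist, the set of all such triangles. Two concentric circles are regarded as the degenerate case of a confocal pair. Excentral family: the set of excentral triangles of the triangles in a confocal family, where the excentral triangle of a triangle $T$ is the triangle whose vertices are the excenters of $T$ (its sides pass through the vertices of $T$ perpendicularly to the internal angle bisectors). Scaling by $\lambda>0$ along an axis: the map multiplying the coordinate along that axis by $\lambda$ and leaving the perpendicular coordinate unchanged.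
   Formalization: For a>b the scaling by 1/s' along the minor axis also sends the circumcircle family to an excentral family, so "unique" is proved as: unique factor among scalings along the major axis, and unique up to a positive homothety among scalings along all axes through the center. *)

theory Defs
  imports "HOL-Analysis.Analysis"
begin

text \<open>The Euclidean plane is \<open>real \<times> real\<close>, whose library norm and inner product are the
  Euclidean ones. A triangle is the set of its three vertices.\<close>

type_synonym point = "real \<times> real"

definition is_triangle :: "point set \<Rightarrow> bool" where
  "is_triangle T \<longleftrightarrow> card T = 3 \<and> \<not> collinear T"

definition side_lines :: "point set \<Rightarrow> point set set" where
  "side_lines T = {affine hull {P, Q} | P Q. P \<in> T \<and> Q \<in> T \<and> P \<noteq> Q}"

definition ellipse :: "real \<Rightarrow> real \<Rightarrow> point set" where
  "ellipse a b = {(x, y). x\<^sup>2 / a\<^sup>2 + y\<^sup>2 / b\<^sup>2 = 1}"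

text \<open>Only used for a line and an ellipse or circle, where being tangent means meeting in
  exactly one point.\<close>

definition tangent :: "point set \<Rightarrow> point set \<Rightarrow> bool" where
  "tangent L C \<longleftrightarrow> (\<exists>!p. p \<in> L \<inter> C)"

definition poncelet_triangles :: "point set \<Rightarrow> point set \<Rightarrow> point set set" where
  "poncelet_triangles E C =
     {T. is_triangle T \<and> T \<subseteq> E \<and> (\<forall>L \<in> side_lines T. tangent L C)}"

definition circumcircle_family :: "real \<Rightarrow> real \<Rightarrow> point set set" where
  "circumcircle_family a b = poncelet_triangles (sphere 0 (a + b)) (ellipse a b)"

text \<open>Neither semi-axis is assumed to be the larger one; \<open>\<alpha> = \<beta>\<close> is the degenerate case of two
  concentric circles.\<close>

definition confocal_pair :: "real \<Rightarrow> real \<Rightarrow> real \<Rightarrow> real \<Rightarrow> bool" where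
  "confocal_pair \<alpha> \<beta> \<alpha>\<^sub>c \<beta>\<^sub>c \<longleftrightarrow>
     0 < \<alpha>\<^sub>c \<and> \<alpha>\<^sub>c < \<alpha> \<and> 0 < \<beta>\<^sub>c \<and> \<beta>\<^sub>c < \<beta> \<and>
     \<alpha>\<^sup>2 - \<beta>\<^sup>2 = \<alpha>\<^sub>c\<^sup>2 - \<beta>\<^sub>c\<^sup>2 \<and>
     poncelet_triangles (ellipse \<alpha> \<beta>) (ellipse \<alpha>\<^sub>c \<beta>\<^sub>c) \<noteq> {}"

definition confocal_family :: "real \<Rightarrow> real \<Rightarrow> real \<Rightarrow> real \<Rightarrow> point set set" where
  "confocal_family \<alpha> \<beta> \<alpha>\<^sub>c \<beta>\<^sub>c = poncelet_triangles (ellipse \<alpha> \<beta>) (ellipse \<alpha>\<^sub>c \<beta>\<^sub>c)"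

text \<open>A triangle has exactly four circles tangent to its three side lines: the incircle, whose
  centre lies inside the triangle, and the three excircles, whose centres lie outside.\<close>

definition excenter :: "point set \<Rightarrow> point \<Rightarrow> bool" where
  "excenter T p \<longleftrightarrow>
     p \<notin> convex hull T \<and> (\<exists>r>0. \<forall>L \<in> side_lines T. tangent L (sphere p r))"

definition excentral_triangle :: "point set \<Rightarrow> point set" where
  "excentral_triangle T = {p. excenter T p}"

definition is_excentral_family :: "point set set \<Rightarrow> bool" where
  "is_excentral_family F \<longleftrightarrow>
     (\<exists>\<alpha> \<beta> \<alpha>\<^sub>c \<beta>\<^sub>c. confocal_pair \<alpha> \<beta> \<alpha>\<^sub>c \<beta>\<^sub>c \<and>
        F = excentral_triangle ` confocal_family \<alpha> \<beta> \<alpha>\<^sub>c \<beta>\<^sub>c)"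

text \<open>Scaling by \<open>l\<close> along the axis through the origin spanned by the unit vector \<open>u\<close>.\<close>

definition scaling :: "point \<Rightarrow> real \<Rightarrow> point \<Rightarrow> point" where
  "scaling u l p = (l * (p \<bullet> u)) *\<^sub>R u + (p - (p \<bullet> u) *\<^sub>R u)"

lemma scaling_x_axis: "scaling (1, 0) l (x, y) = (l * x, y)"
  by (simp add: scaling_def)

lemma scaling_y_axis: "scaling (0, 1) l (x, y) = (x, l * y)"
  by (simp add: scaling_def)

definition sends_to_excentral :: "(point \<Rightarrow> point) \<Rightarrow> real \<Rightarrow> real \<Rightarrow> bool" where
  "sends_to_excentral f a b \<longleftrightarrow> is_excentral_family ((\<lambda>T. f ` T) ` circumcircle_family a b)"

end

theory Submission
  imports Defs
begin

text \<open>Polarity in an ellipse \<open>\<E>\<close> with semi-axes \<open>\<alpha>, \<beta>\<close> is the heart of the proof. A triangle inscribed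
  in \<open>\<E>\<close> has as polar triangle the one formed by the tangents of \<open>\<E>\<close> at its vertices. Since polarity
  is an involution that exchanges vertices with sides and turns a coaxial ellipse with semi-axes
  \<open>c, d\<close> into one with semi-axes \<open>\<alpha>\<^sup>2 / c, \<beta>\<^sup>2 / d\<close>, it maps the Poncelet triangles between two coaxial
  ellipses onto those between the two polar ellipses (\<open>polar_triangle\<close>).

  For a caustic confocal to \<open>\<E>\<close>, the optical property makes the tangent of \<open>\<E>\<close> at a vertex an external
  angle bisector. The polar triangle is then the excentral triangle, and the excentral family of a
  confocal pair is exactly the Poncelet family between the ellipse with semi-axes
  \<open>\<alpha>\<^sup>2 / \<alpha>\<^sub>c, \<beta>\<^sup>2 / \<beta>\<^sub>c\<close> and \<open>\<E>\<close> (\<open>excentral_image_confocal_family\<close>).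

  Scaling the circumcircle family by \<open>m\<close> along the first axis gives the Poncelet family between
  the ellipses with semi-axes \<open>m (a + b), a + b\<close> and \<open>m a, b\<close>. It is excentral once
  \<open>\<alpha>\<^sub>c = m a\<^sup>2 / (a + b)\<close> and \<open>\<beta>\<^sub>c = b\<^sup>2 / (a + b)\<close> satisfy the confocality equation, which reads
  \<open>m\<^sup>2 a (2a + b) = b (a + 2b)\<close>.

  Conversely, one isosceles triangle of the circumcircle family determines everything: its three
  side lines, being tangent both to the image of the caustic and to the inner ellipse of an excentral
  family, force these two centred conics to coincide. This makes the matrix of the scaling diagonal; two
  vertices then determine the outer ellipse, and confocality gives the same equation for the ratio
  of the two scale factors.\<close>

section \<open>Tangency in coordinates\<close>

definition wedge :: "point \<Rightarrow> point \<Rightarrow> real" where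
  "wedge P Q = fst P * snd Q - snd P * fst Q"

lemma wedge_simps [simp]: "wedge 0 P = 0" "wedge P 0 = 0" "wedge P P = 0"
  by (simp_all add: wedge_def)

text \<open>The points \<open>Q\<close> with \<open>polar_form a b P Q = 1\<close> form the polar line of \<open>P\<close> in \<open>ellipse a b\<close>, which
  is the tangent at \<open>P\<close> if \<open>P\<close> lies on the ellipse.\<close>

definition polar_form :: "real \<Rightarrow> real \<Rightarrow> point \<Rightarrow> point \<Rightarrow> real" where
  "polar_form a b P Q = fst P * fst Q / a\<^sup>2 + snd P * snd Q / b\<^sup>2"

lemma polar_form_commute: "polar_form a b P Q = polar_form a b Q P"
  by (simp add: polar_form_def mult.commute)

lemma mem_ellipse_iff: "P \<in> ellipse a b \<longleftrightarrow> polar_form a b P P = 1"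
  by (cases P) (simp add: ellipse_def polar_form_def power2_eq_square)

lemma sphere_eq_ellipse:
  assumes "r > 0"
  shows "sphere 0 r = ellipse r r"
proof -
  have "sqrt (x\<^sup>2 + y\<^sup>2) = r \<longleftrightarrow> x\<^sup>2 / r\<^sup>2 + y\<^sup>2 / r\<^sup>2 = 1" for x y
  proof -
    have "sqrt (x\<^sup>2 + y\<^sup>2) = r \<longleftrightarrow> x\<^sup>2 + y\<^sup>2 = r\<^sup>2"
      using assms real_sqrt_eq_iff[of "x\<^sup>2 + y\<^sup>2" "r\<^sup>2"] by simp
    also have "\<dots> \<longleftrightarrow> x\<^sup>2 / r\<^sup>2 + y\<^sup>2 / r\<^sup>2 = 1"
      using assms unfolding add_divide_distrib[symmetric] by auto
    finally show ?thesis .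
  qed
  then show ?thesis by (auto simp: ellipse_def norm_Pair)
qed

lemma ex1_root_quadratic_iff:
  fixes A B C :: real
  assumes "A \<noteq> 0"
  shows "(\<exists>!t. A * t\<^sup>2 + 2 * B * t + C = 0) \<longleftrightarrow> B\<^sup>2 = A * C"
proof -
  have root: "A * t\<^sup>2 + 2 * B * t + C = 0 \<longleftrightarrow> (A * t + B)\<^sup>2 = B\<^sup>2 - A * C" for t
  proof -
    have "A * (A * t\<^sup>2 + 2 * B * t + C) = (A * t + B)\<^sup>2 - (B\<^sup>2 - A * C)"
      by (simp add: power2_eq_square algebra_simps)
    then show ?thesis using assms by (metis eq_iff_diff_eq_0 mult_eq_0_iff)
  qed
  show ?thesis
  proof
    assume "B\<^sup>2 = A * C"
    then have "A * t\<^sup>2 + 2 * B * t + C = 0 \<longleftrightarrow> t = - B / A" for t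
      unfolding root using assms by (auto simp: field_simps)
    then show "\<exists>!t. A * t\<^sup>2 + 2 * B * t + C = 0" by simp
  next
    assume ex1: "\<exists>!t. A * t\<^sup>2 + 2 * B * t + C = 0"
    then obtain t where t: "(A * t + B)\<^sup>2 = B\<^sup>2 - A * C" unfolding root by blast
    \<comment> \<open>the roots come in pairs symmetric about \<open>- B / A\<close>\<close>
    have "A * (- t - 2 * B / A) + B = - (A * t + B)" using assms by (simp add: field_simps)
    then have "(A * (- t - 2 * B / A) + B)\<^sup>2 = B\<^sup>2 - A * C" using t by (metis power2_minus)
    with t ex1 have "t = - t - 2 * B / A" unfolding root by blast
    then have "A * t + B = 0" using assms by (simp add: field_simps)
    with t show "B\<^sup>2 = A * C" by simp
  qed
qed

lemma ex1_mem_range_iff: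
  assumes "inj f"
  shows "(\<exists>!p. p \<in> range f \<inter> C) \<longleftrightarrow> (\<exists>!t. f t \<in> C)"
proof
  assume "\<exists>!p. p \<in> range f \<inter> C"
  then obtain t where "f t \<in> C" "\<And>p. p \<in> range f \<inter> C \<Longrightarrow> p = f t" by blast
  with assms have "f u \<in> C \<longleftrightarrow> u = t" for u by (metis IntI injD rangeI)
  then show "\<exists>!t. f t \<in> C" by simp
next
  assume "\<exists>!t. f t \<in> C"
  then obtain t where "f t \<in> C" "\<And>u. f u \<in> C \<Longrightarrow> u = t" by blast
  then have "p \<in> range f \<inter> C \<longleftrightarrow> p = f t" for p by blast
  then show "\<exists>!p. p \<in> range f \<inter> C" by simp
qed

lemma tangent_line_iff_ex1_param:
  assumes "P \<noteq> Q"
  shows "tangent (affine hull {P, Q}) C \<longleftrightarrow> (\<exists>!t. P + t *\<^sub>R (Q - P) \<in> C)"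
proof -
  define f where "f t = P + t *\<^sub>R (Q - P)" for t :: real
  have "inj f" using assms by (auto simp: inj_def f_def)
  from ex1_mem_range_iff[OF this] show ?thesis by (simp add: tangent_def affine_hull_2_alt f_def)
qed

text \<open>The vanishing discriminant of the quadratic in the line parameter is the equation of the dual
  conic: a line with normal vector \<open>n\<close> at \<open>n \<bullet> p = e\<close> touches the ellipse iff
  \<open>a\<^sup>2 n\<^sub>1\<^sup>2 + b\<^sup>2 n\<^sub>2\<^sup>2 = e\<^sup>2\<close>. Here \<open>n\<close> is \<open>Q - P\<close> turned by a right angle and \<open>e\<close> is, up to sign, the wedge
  of \<open>P\<close> and \<open>Q\<close>.\<close>

lemma tangent_ellipse_iff:
  assumes "a > 0" "b > 0" "P \<noteq> Q"
  shows "tangent (affine hull {P, Q}) (ellipse a b) \<longleftrightarrow>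
    (wedge P Q)\<^sup>2 = a\<^sup>2 * (snd Q - snd P)\<^sup>2 + b\<^sup>2 * (fst Q - fst P)\<^sup>2"
proof -
  obtain x y where P: "P = (x, y)" by (cases P)
  obtain z w where Q: "Q = (z, w)" by (cases Q)
  define d where "d = z - x"
  define e where "e = w - y"
  have z: "z = x + d" and w: "w = y + e" by (auto simp: d_def e_def)
  define A where "A = b\<^sup>2 * d\<^sup>2 + a\<^sup>2 * e\<^sup>2"
  define B where "B = b\<^sup>2 * x * d + a\<^sup>2 * y * e"
  define C where "C = b\<^sup>2 * x\<^sup>2 + a\<^sup>2 * y\<^sup>2 - a\<^sup>2 * b\<^sup>2"
  have "d \<noteq> 0 \<or> e \<noteq> 0" using assms(3) by (auto simp: P Q d_def e_def)
  then have A: "A > 0" unfolding A_def using assms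
    by (metis add_nonneg_pos add_pos_nonneg mult_pos_pos zero_le_mult_iff zero_le_power2 zero_less_power2 less_numeral_extra(3))
  have mem: "P + t *\<^sub>R (Q - P) \<in> ellipse a b \<longleftrightarrow> A * t\<^sup>2 + 2 * B * t + C = 0" for t
  proof -
    have "(x + t * d)\<^sup>2 / a\<^sup>2 + (y + t * e)\<^sup>2 / b\<^sup>2 - 1 = (A * t\<^sup>2 + 2 * B * t + C) / (a\<^sup>2 * b\<^sup>2)"
      using assms by (simp add: A_def B_def C_def field_simps power2_eq_square)
    then have "(x + t * d)\<^sup>2 / a\<^sup>2 + (y + t * e)\<^sup>2 / b\<^sup>2 = 1 \<longleftrightarrow> A * t\<^sup>2 + 2 * B * t + C = 0"
      using assms by (smt (verit) divide_eq_0_iff mult_eq_0_iff zero_less_power)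
    then show ?thesis by (simp add: P Q ellipse_def z w)
  qed
  have "B\<^sup>2 - A * C = a\<^sup>2 * b\<^sup>2 * (A - (x * e - y * d)\<^sup>2)"
    unfolding A_def B_def C_def by algebra
  then have "B\<^sup>2 = A * C \<longleftrightarrow> (x * e - y * d)\<^sup>2 = A"
    using assms by (smt (verit) mult_eq_0_iff zero_less_power)
  moreover have "wedge P Q = x * e - y * d"
    by (simp add: P Q wedge_def z w algebra_simps)
  ultimately show ?thesis
    unfolding tangent_line_iff_ex1_param[OF assms(3)] mem
    using ex1_root_quadratic_iff[of A B C] A by (simp add: P Q z w A_def add.commute)
qed

lemma tangent_sphere_iff:
  assumes "r > 0" "P \<noteq> Q"
  shows "tangent (affine hull {P, Q}) (sphere c r) \<longleftrightarrow>
    (wedge (Q - P) (c - P))\<^sup>2 = r\<^sup>2 * (norm (Q - P))\<^sup>2"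
proof -
  define P' Q' where "P' = P - c" and "Q' = Q - c"
  have ne: "P' \<noteq> Q'" using assms(2) by (simp add: P'_def Q'_def)
  have "P + t *\<^sub>R (Q - P) \<in> sphere c r \<longleftrightarrow> P' + t *\<^sub>R (Q' - P') \<in> sphere 0 r" for t
    by (simp add: P'_def Q'_def dist_norm norm_minus_commute[of c] algebra_simps)
  then have "tangent (affine hull {P, Q}) (sphere c r) \<longleftrightarrow> tangent (affine hull {P', Q'}) (ellipse r r)"
    unfolding tangent_line_iff_ex1_param[OF assms(2)] tangent_line_iff_ex1_param[OF ne]
      sphere_eq_ellipse[OF assms(1)] by simp
  also have "\<dots> \<longleftrightarrow> (wedge P' Q')\<^sup>2 = r\<^sup>2 * (norm (Q - P))\<^sup>2"
    unfolding tangent_ellipse_iff[OF assms(1,1) ne]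
    by (simp add: P'_def Q'_def norm_prod_def algebra_simps)
  also have "wedge P' Q' = wedge (Q - P) (c - P)"
    by (simp add: wedge_def P'_def Q'_def algebra_simps)
  finally show ?thesis .
qed

section \<open>Triangles\<close>

lemma collinear_3_iff_wedge: "collinear {P, Q, R} \<longleftrightarrow> wedge (Q - P) (R - P) = 0"
proof -
  have "collinear {P, Q, R} \<longleftrightarrow> collinear {0, Q - P, R - P}"
    using collinear_3[of Q P R] by (simp add: insert_commute)
  also have "\<dots> \<longleftrightarrow> wedge (Q - P) (R - P) = 0"
  proof -
    obtain x y where d: "Q - P = (x, y)" by (cases "Q - P")
    obtain z w where e: "R - P = (z, w)" by (cases "R - P")
    have "x = 0 \<and> y = 0 \<or> z = 0 \<and> w = 0 \<or> (\<exists>c. z = c * x \<and> w = c * y)"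
      if 0: "x * w = y * z"
    proof (cases "x = 0")
      case True
      show ?thesis
      proof (cases "y = 0")
        case False
        with True 0 have "z = (w / y) * x \<and> w = (w / y) * y" by simp
        then show ?thesis by blast
      qed (use True in simp)
    next
      case False
      with 0 have "z = (z / x) * x \<and> w = (z / x) * y" by (simp add: field_simps)
      then show ?thesis by blast
    qed
    then have "x = 0 \<and> y = 0 \<or> z = 0 \<and> w = 0 \<or> (\<exists>c. z = c * x \<and> w = c * y) \<longleftrightarrow>
        x * w = y * z"
      by (auto simp: mult_ac)
    then show ?thesis
      unfolding d e collinear_lemma by (simp add: wedge_def zero_prod_def)
  qed
  finally show ?thesis .
qed

lemma is_triangle_iff_wedge: "is_triangle {P, Q, R} \<longleftrightarrow> wedge (Q - P) (R - P) \<noteq> 0"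
proof -
  have "wedge (Q - P) (R - P) \<noteq> 0 \<Longrightarrow> P \<noteq> Q \<and> Q \<noteq> R \<and> P \<noteq> R"
    by auto
  then have "wedge (Q - P) (R - P) \<noteq> 0 \<Longrightarrow> card {P, Q, R} = 3" by simp
  then show ?thesis unfolding is_triangle_def collinear_3_iff_wedge by blast
qed

lemma is_triangleE:
  assumes "is_triangle T"
  obtains P Q R where "T = {P, Q, R}" "P \<noteq> Q" "Q \<noteq> R" "P \<noteq> R"
proof -
  have "card T = 3" using assms by (simp add: is_triangle_def)
  then show ?thesis using that unfolding card_3_iff by blast
qed

lemma ball_side_lines_iff:
  "(\<forall>L \<in> side_lines T. tangent L C) \<longleftrightarrow>
     (\<forall>P\<in>T. \<forall>Q\<in>T. P \<noteq> Q \<longrightarrow> tangent (affine hull {P, Q}) C)"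
  unfolding side_lines_def by blast

text \<open>The quadratic that describes an ellipse along a line has at most two roots.\<close>

lemma is_triangle_of_ellipse_points:
  assumes "a > 0" "b > 0" "P \<noteq> Q" "Q \<noteq> R" "P \<noteq> R" "{P, Q, R} \<subseteq> ellipse a b"
  shows "is_triangle {P, Q, R}"
proof (rule ccontr)
  assume "\<not> is_triangle {P, Q, R}"
  then have "collinear {0, Q - P, R - P}"
    using collinear_3_iff_wedge[of P Q R] is_triangle_iff_wedge collinear_3[of Q P R] 
    by (simp add: insert_commute)
  then obtain t where t: "R - P = t *\<^sub>R (Q - P)"
    using assms by (auto simp: collinear_lemma)
  obtain x y where P: "P = (x, y)" by (cases P)
  obtain d e where d: "Q - P = (d, e)" by (cases "Q - P")
  have Q: "Q = (x + d, y + e)" using d P by (metis add.commute add_Pair diff_add_cancel)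
  have R: "R = (x + t * d, y + t * e)"
    using t d P by (metis add.commute add_Pair diff_add_cancel scaleR_Pair real_scaleR_def)
  define A where "A = d\<^sup>2 / a\<^sup>2 + e\<^sup>2 / b\<^sup>2"
  define B where "B = 2 * (x * d / a\<^sup>2 + y * e / b\<^sup>2)"
  have q: "polar_form a b (x + u * d, y + u * e) (x + u * d, y + u * e) =
      polar_form a b P P + u * B + u\<^sup>2 * A" for u
    by (simp add: P polar_form_def A_def B_def power2_eq_square add_divide_distrib algebra_simps)
  have "A + B = 0" "t * B + t\<^sup>2 * A = 0"
    using q[of 1] q[of t] assms(6) by (auto simp: mem_ellipse_iff Q R)
  then have "A * (t * (t - 1)) = 0" by algebra
  moreover have "A \<noteq> 0"
  proof -
    have "d \<noteq> 0 \<or> e \<noteq> 0" using assms(3) by (auto simp: P Q)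
    then show ?thesis unfolding A_def using assms(1,2)
      by (auto simp: add_nonneg_eq_0_iff)
  qed
  ultimately have "t = 0 \<or> t = 1" by simp
  then show False using assms(4,5) by (auto simp: P Q R)
qed

section \<open>Excenters\<close>

text \<open>The barycentric coordinates of a point equidistant from the side lines are, up to a common
  factor, the side lengths with signs. They sum to \<open>1\<close>, so by the triangle inequality at most one
  sign is negative; none is negative exactly for the incenter, which lies in the triangle. The
  bound turns any three distinct excenters into all of them.\<close>

lemma excentral_triangle_le_3:
  assumes "is_triangle {P1, P2, P3}"
  shows "finite (excentral_triangle {P1, P2, P3}) \<and> card (excentral_triangle {P1, P2, P3}) \<le> 3"
proof -
  define D where "D = wedge (P2 - P1) (P3 - P1)"
  define L1 L2 L3 where "L1 = norm (P3 - P2)" and "L2 = norm (P1 - P3)" and "L3 = norm (P2 - P1)"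
  have D: "D \<noteq> 0" using assms by (simp add: is_triangle_iff_wedge D_def)
  have ne: "P1 \<noteq> P2" "P2 \<noteq> P3" "P3 \<noteq> P1" using D by (auto simp: D_def wedge_def algebra_simps)
  have L_pos: "L1 > 0" "L2 > 0" "L3 > 0" using ne by (auto simp: L1_def L2_def L3_def)
  have tri: "L1 \<le> L2 + L3" "L2 \<le> L1 + L3" "L3 \<le> L1 + L2"
    unfolding L1_def L2_def L3_def
    using norm_triangle_ineq[of "P3 - P1" "P1 - P2"] norm_triangle_ineq[of "P1 - P2" "P2 - P3"]
      norm_triangle_ineq[of "P2 - P3" "P3 - P1"]
    by (simp_all add: norm_minus_commute)
  define E where "E l1 l2 l3 = (1 / (l1 + l2 + l3)) *\<^sub>R (l1 *\<^sub>R P1 + l2 *\<^sub>R P2 + l3 *\<^sub>R P3)"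
    for l1 l2 l3 :: real
  have "excentral_triangle {P1, P2, P3} \<subseteq> {E (-L1) L2 L3, E L1 (-L2) L3, E L1 L2 (-L3)}"
  proof
    fix p assume "p \<in> excentral_triangle {P1, P2, P3}"
    then obtain r where r: "r > 0" and notin: "p \<notin> convex hull {P1, P2, P3}"
      and tan: "\<And>P Q. P \<in> {P1, P2, P3} \<Longrightarrow> Q \<in> {P1, P2, P3} \<Longrightarrow> P \<noteq> Q \<Longrightarrow>
        tangent (affine hull {P, Q}) (sphere p r)"
      by (auto simp: excentral_triangle_def excenter_def ball_side_lines_iff)
    define h1 h2 h3 where "h1 = wedge (P3 - P2) (p - P2) / D"
      and "h2 = wedge (P1 - P3) (p - P3) / D" and "h3 = wedge (P2 - P1) (p - P1) / D"
    define \<rho> where "\<rho> = r / \<bar>D\<bar>"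
    have \<rho>: "\<rho> > 0" using r D by (simp add: \<rho>_def)
    have sq: "h1\<^sup>2 = (\<rho> * L1)\<^sup>2" "h2\<^sup>2 = (\<rho> * L2)\<^sup>2" "h3\<^sup>2 = (\<rho> * L3)\<^sup>2"
      using tan[of P2 P3] tan[of P3 P1] tan[of P1 P2] ne r
      by (simp_all add: tangent_sphere_iff h1_def h2_def h3_def \<rho>_def L1_def L2_def L3_def
          power_mult_distrib power_divide)
    have Dh: "D * h1 = wedge (P3 - P2) (p - P2)" "D * h2 = wedge (P1 - P3) (p - P3)"
      "D * h3 = wedge (P2 - P1) (p - P1)"
      using D by (simp_all add: h1_def h2_def h3_def)
    have "D * (h1 + h2 + h3) = D"
      unfolding distrib_left Dh unfolding D_def by (simp add: wedge_def algebra_simps)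
    then have sum: "h1 + h2 + h3 = 1" using D by simp
    have "D *\<^sub>R p = (D * h1) *\<^sub>R P1 + (D * h2) *\<^sub>R P2 + (D * h3) *\<^sub>R P3"
      unfolding Dh unfolding D_def by (simp add: wedge_def prod_eq_iff algebra_simps)
    also have "\<dots> = D *\<^sub>R (h1 *\<^sub>R P1 + h2 *\<^sub>R P2 + h3 *\<^sub>R P3)"
      by (simp add: scaleR_add_right)
    finally have p: "p = h1 *\<^sub>R P1 + h2 *\<^sub>R P2 + h3 *\<^sub>R P3" using D by simp
    have signed: "\<exists>l. (l = L \<or> l = - L) \<and> h = \<rho> * l" if "h\<^sup>2 = (\<rho> * L)\<^sup>2" for h L
      using that by (metis mult_minus_right power2_eq_iff)
    obtain l1 l2 l3 where l: "l1 = L1 \<or> l1 = - L1" "l2 = L2 \<or> l2 = - L2" "l3 = L3 \<or> l3 = - L3"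
      and h: "h1 = \<rho> * l1" "h2 = \<rho> * l2" "h3 = \<rho> * l3"
      using sq[THEN signed] by blast
    have \<rho>_sum: "\<rho> * (l1 + l2 + l3) = 1" using sum h by (simp add: distrib_left)
    then have "l1 + l2 + l3 > 0" using \<rho> by (metis zero_less_mult_pos zero_less_one)
    moreover have "\<not> (l1 \<ge> 0 \<and> l2 \<ge> 0 \<and> l3 \<ge> 0)"
      using notin sum p h \<rho> by (auto simp: convex_hull_3)
    ultimately have "l1 = - L1 \<and> l2 = L2 \<and> l3 = L3 \<or> l1 = L1 \<and> l2 = - L2 \<and> l3 = L3 \<or>
        l1 = L1 \<and> l2 = L2 \<and> l3 = - L3"
      using l tri L_pos by linarith
    moreover have "p = E l1 l2 l3"
    proof -
      have "\<rho> = 1 / (l1 + l2 + l3)" using \<rho>_sum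
        by (metis nonzero_eq_divide_eq mult_zero_right zero_neq_one)
      then show ?thesis unfolding p E_def h by (simp add: scaleR_add_right)
    qed
    ultimately show "p \<in> {E (-L1) L2 L3, E L1 (-L2) L3, E L1 L2 (-L3)}" by blast
  qed
  moreover have "finite {E (-L1) L2 L3, E L1 (-L2) L3, E L1 L2 (-L3)}"
    "card {E (-L1) L2 L3, E L1 (-L2) L3, E L1 L2 (-L3)} \<le> 3"
    by (auto simp: card_insert_if)
  ultimately show ?thesis by (meson card_mono finite_subset le_trans)
qed

section \<open>The optical property of confocal ellipses\<close>

text \<open>Every point \<open>Q\<close> of the tangent at \<open>P\<close> has the same distance from both tangents drawn from \<open>P\<close> to
  the confocal ellipse. Indeed, let \<open>n\<close> be the unit normal of a line through \<open>P\<close>. The line touches the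
  confocal ellipse iff \<open>n\<close> is isotropic for the form \<open>\<alpha>\<^sup>2 n\<^sub>1\<^sup>2 + \<beta>\<^sup>2 n\<^sub>2\<^sup>2 - (n \<bullet> P)\<^sup>2 - \<mu> (n \<bullet> n)\<close>. The axes of
  this form are the tangent and the normal of the outer ellipse at \<open>P\<close>, so the component of \<open>n\<close> along
  the tangent is determined up to sign.\<close>

lemma confocal_optical_property:
  assumes pos: "\<alpha> > 0" "\<beta> > 0" "\<alpha>\<^sub>c > 0" "\<beta>\<^sub>c > 0"
    and confocal: "\<alpha>\<^sub>c < \<alpha>" "\<alpha>\<^sup>2 - \<beta>\<^sup>2 = \<alpha>\<^sub>c\<^sup>2 - \<beta>\<^sub>c\<^sup>2"
    and P: "P \<in> ellipse \<alpha> \<beta>" and Q: "polar_form \<alpha> \<beta> P Q = 1" "Q \<noteq> P"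
  shows "\<exists>r>0. \<forall>P'. P' \<noteq> P \<longrightarrow> tangent (affine hull {P, P'}) (ellipse \<alpha>\<^sub>c \<beta>\<^sub>c) \<longrightarrow>
    tangent (affine hull {P, P'}) (sphere Q r)"
proof -
  define X Y where "X = fst P / \<alpha>" and "Y = snd P / \<beta>"
  have P': "fst P = \<alpha> * X" "snd P = \<beta> * Y" using pos by (simp_all add: X_def Y_def)
  have XY: "X\<^sup>2 + Y\<^sup>2 = 1"
    using P by (cases P) (simp add: X_def Y_def ellipse_def power_divide)
  define ex ey where "ex = fst (Q - P)" and "ey = snd (Q - P)"
  \<comment> \<open>\<open>Q - P\<close> is \<open>\<tau>\<close> times the tangent vector of the parametrized ellipse at \<open>P\<close>\<close>
  define \<tau> where "\<tau> = X * ey / \<beta> - Y * ex / \<alpha>"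
  have "polar_form \<alpha> \<beta> P (Q - P) = 0"
    using P Q(1) by (simp add: mem_ellipse_iff polar_form_def diff_divide_distrib right_diff_distrib)
  then have "X * (ex / \<alpha>) + Y * (ey / \<beta>) = 0"
    using pos by (simp add: polar_form_def P' ex_def ey_def power2_eq_square)
  with XY have "ex / \<alpha> = - \<tau> * Y" "ey / \<beta> = \<tau> * X"
    unfolding \<tau>_def by algebra+
  then have e: "ex = - \<tau> * \<alpha> * Y" "ey = \<tau> * \<beta> * X"
    using pos by (simp_all add: field_simps)
  have "\<tau> \<noteq> 0" using Q(2) e by (auto simp: ex_def ey_def prod_eq_iff)
  define \<mu> where "\<mu> = \<alpha>\<^sup>2 - \<alpha>\<^sub>c\<^sup>2"
  have \<mu>: "\<mu> > 0" using confocal(1) pos by (simp add: \<mu>_def power_strict_mono)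
  have c: "\<alpha>\<^sub>c\<^sup>2 = \<alpha>\<^sup>2 - \<mu>" "\<beta>\<^sub>c\<^sup>2 = \<beta>\<^sup>2 - \<mu>" using confocal(2) by (simp_all add: \<mu>_def)
  define r where "r = \<bar>\<tau>\<bar> * sqrt \<mu>"
  have r: "r > 0" "r\<^sup>2 = \<tau>\<^sup>2 * \<mu>"
    using \<mu> \<open>\<tau> \<noteq> 0\<close> by (simp_all add: r_def power_mult_distrib)
  have "tangent (affine hull {P, P'}) (sphere Q r)"
    if "P' \<noteq> P" "tangent (affine hull {P, P'}) (ellipse \<alpha>\<^sub>c \<beta>\<^sub>c)" for P'
  proof -
    define dx dy where "dx = fst (P' - P)" and "dy = snd (P' - P)"
    have "wedge P P' = \<alpha> * X * dy - \<beta> * Y * dx"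
      by (simp add: wedge_def dx_def dy_def P' algebra_simps)
    then have "(\<alpha> * X * dy - \<beta> * Y * dx)\<^sup>2 = (\<alpha>\<^sup>2 - \<mu>) * dy\<^sup>2 + (\<beta>\<^sup>2 - \<mu>) * dx\<^sup>2"
      using that tangent_ellipse_iff[of \<alpha>\<^sub>c \<beta>\<^sub>c P P'] pos by (simp add: c dx_def dy_def)
    \<comment> \<open>Lagrange's identity for \<open>(X, Y)\<close> and \<open>(\<beta> * dx, \<alpha> * dy)\<close>\<close>
    then have "(\<beta> * X * dx + \<alpha> * Y * dy)\<^sup>2 = \<mu> * (dx\<^sup>2 + dy\<^sup>2)"
      using XY by algebra
    moreover have "wedge (P' - P) (Q - P) = \<tau> * (\<beta> * X * dx + \<alpha> * Y * dy)"
      using e by (simp add: wedge_def dx_def dy_def ex_def ey_def) (simp add: algebra_simps)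
    ultimately have "(wedge (P' - P) (Q - P))\<^sup>2 = r\<^sup>2 * (dx\<^sup>2 + dy\<^sup>2)"
      using r(2) by (simp add: power_mult_distrib)
    moreover have "(norm (P' - P))\<^sup>2 = dx\<^sup>2 + dy\<^sup>2"
      by (simp add: norm_prod_def dx_def dy_def)
    ultimately show ?thesis
      using tangent_sphere_iff[OF r(1) that(1)[symmetric]] by simp
  qed
  with r(1) show ?thesis by blast
qed

lemma tangent_spheres_radius_eq:
  assumes "r > 0" "s > 0" "P \<noteq> Q"
    and "tangent (affine hull {P, Q}) (sphere c r)" "tangent (affine hull {P, Q}) (sphere c s)"
  shows "r = s"
proof -
  have "r\<^sup>2 * (norm (Q - P))\<^sup>2 = s\<^sup>2 * (norm (Q - P))\<^sup>2"
    using assms by (simp add: tangent_sphere_iff)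
  then show ?thesis using assms by simp
qed

lemma polar_form_lt_1:
  assumes "\<alpha> > 0" "\<beta> > 0" "P \<in> ellipse \<alpha> \<beta>" "Q \<in> ellipse \<alpha> \<beta>" "P \<noteq> Q"
  shows "polar_form \<alpha> \<beta> P Q < 1"
proof -
  have "polar_form \<alpha> \<beta> (P - Q) (P - Q) > 0"
  proof -
    have "fst (P - Q) \<noteq> 0 \<or> snd (P - Q) \<noteq> 0" using assms(5) by (auto simp: prod_eq_iff)
    then show ?thesis unfolding polar_form_def power2_eq_square[symmetric]
      using assms(1,2) by (auto intro: add_pos_nonneg add_nonneg_pos)
  qed
  moreover have "polar_form \<alpha> \<beta> (P - Q) (P - Q) =
      polar_form \<alpha> \<beta> P P + polar_form \<alpha> \<beta> Q Q - 2 * polar_form \<alpha> \<beta> P Q"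
    by (simp add: polar_form_def diff_divide_distrib add_divide_distrib algebra_simps)
  ultimately show ?thesis using assms(3,4) by (simp add: mem_ellipse_iff)
qed

text \<open>The tangents at two vertices meet in a point that is equidistant from all three sides by the
  optical property at both vertices. It lies outside the triangle because the tangent at \<open>P2\<close> is a
  supporting line that meets the triangle only in \<open>P2\<close>.\<close>

lemma pole_is_excenter:
  assumes pos: "\<alpha> > 0" "\<beta> > 0" "\<alpha>\<^sub>c > 0" "\<beta>\<^sub>c > 0"
    and confocal: "\<alpha>\<^sub>c < \<alpha>" "\<alpha>\<^sup>2 - \<beta>\<^sup>2 = \<alpha>\<^sub>c\<^sup>2 - \<beta>\<^sub>c\<^sup>2"
    and ne: "P1 \<noteq> P2" "P2 \<noteq> P3" "P1 \<noteq> P3"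
    and on: "{P1, P2, P3} \<subseteq> ellipse \<alpha> \<beta>"
    and tan: "\<forall>L \<in> side_lines {P1, P2, P3}. tangent L (ellipse \<alpha>\<^sub>c \<beta>\<^sub>c)"
    and Q: "polar_form \<alpha> \<beta> P2 Q = 1" "polar_form \<alpha> \<beta> P3 Q = 1"
  shows "excenter {P1, P2, P3} Q"
proof -
  have lt: "polar_form \<alpha> \<beta> P2 P1 < 1" "polar_form \<alpha> \<beta> P2 P3 < 1" "polar_form \<alpha> \<beta> P3 P2 < 1"
    using polar_form_lt_1 pos on ne by auto
  have self: "polar_form \<alpha> \<beta> P2 P2 = 1" using on by (simp add: mem_ellipse_iff)
  have Q_ne: "Q \<noteq> P2" "Q \<noteq> P3" using Q lt by auto
  have tan': "tangent (affine hull {P, P'}) (ellipse \<alpha>\<^sub>c \<beta>\<^sub>c)"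
    if "P \<in> {P1, P2, P3}" "P' \<in> {P1, P2, P3}" "P \<noteq> P'" for P P'
    using tan that unfolding ball_side_lines_iff by blast
  obtain r where r: "r > 0"
    and r_tan: "\<And>P'. P' \<in> {P1, P3} \<Longrightarrow> tangent (affine hull {P2, P'}) (sphere Q r)"
    using confocal_optical_property[OF pos confocal, of P2 Q] on Q Q_ne tan' ne
    by (metis insertCI insertE empty_iff insert_subset)
  obtain s where s: "s > 0"
    and s_tan: "\<And>P'. P' \<in> {P1, P2} \<Longrightarrow> tangent (affine hull {P3, P'}) (sphere Q s)"
    using confocal_optical_property[OF pos confocal, of P3 Q] on Q Q_ne tan' ne
    by (metis insertCI insertE empty_iff insert_subset)
  \<comment> \<open>the common side \<open>P2 P3\<close> forces both radii to agree\<close>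
  have "r = s"
    using tangent_spheres_radius_eq[OF r s ne(2)] r_tan[of P3] s_tan[of P2]
    by (simp add: insert_commute)
  then have sides: "\<forall>L \<in> side_lines {P1, P2, P3}. tangent L (sphere Q r)"
    unfolding ball_side_lines_iff using r_tan s_tan by (auto simp: insert_commute)
  have "Q \<notin> convex hull {P1, P2, P3}"
  proof
    assume "Q \<in> convex hull {P1, P2, P3}"
    then obtain u v w where uvw: "u \<ge> 0" "v \<ge> 0" "w \<ge> 0" "u + v + w = 1"
      and Q_eq: "Q = u *\<^sub>R P1 + v *\<^sub>R P2 + w *\<^sub>R P3"
      by (auto simp: convex_hull_3)
    have "polar_form \<alpha> \<beta> P2 Q = u * polar_form \<alpha> \<beta> P2 P1 + v * polar_form \<alpha> \<beta> P2 P2 +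
        w * polar_form \<alpha> \<beta> P2 P3"
      by (simp add: Q_eq polar_form_def add_divide_distrib algebra_simps)
    then have "u * (1 - polar_form \<alpha> \<beta> P2 P1) + w * (1 - polar_form \<alpha> \<beta> P2 P3) = 0"
      using Q(1) self uvw(4) by (simp add: algebra_simps)
    moreover have "u * (1 - polar_form \<alpha> \<beta> P2 P1) \<ge> 0" "w * (1 - polar_form \<alpha> \<beta> P2 P3) \<ge> 0"
      using uvw lt by simp_all
    ultimately have "u * (1 - polar_form \<alpha> \<beta> P2 P1) = 0" "w * (1 - polar_form \<alpha> \<beta> P2 P3) = 0"
      by linarith+
    then have "u = 0" "w = 0" using lt by auto
    then show False using uvw(4) Q_eq Q_ne by simp
  qed
  with r sides show ?thesis unfolding excenter_def by blast
qed

section \<open>Polar triangles\<close>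

text \<open>Three points on the polar line of \<open>Q\<close> are collinear.\<close>

lemma not_triangle_of_common_polar:
  assumes "polar_form \<alpha> \<beta> P1 Q = 1" "polar_form \<alpha> \<beta> P2 Q = 1" "polar_form \<alpha> \<beta> P3 Q = 1"
  shows "\<not> is_triangle {P1, P2, P3}"
proof -
  define m n where "m = fst Q / \<alpha>\<^sup>2" and "n = snd Q / \<beta>\<^sup>2"
  have eq: "fst P1 * m + snd P1 * n = 1" "fst P2 * m + snd P2 * n = 1" "fst P3 * m + snd P3 * n = 1"
    using assms by (simp_all add: polar_form_def m_def n_def)
  have "m * wedge (P2 - P1) (P3 - P1) = 0" "n * wedge (P2 - P1) (P3 - P1) = 0"
    using eq by (simp add: wedge_def, algebra)+
  moreover have "m \<noteq> 0 \<or> n \<noteq> 0" using eq(1) by auto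
  ultimately show ?thesis by (auto simp: is_triangle_iff_wedge)
qed

text \<open>The pole of the line \<open>P Q\<close>, obtained by Cramer's rule from the two equations
  \<open>polar_form \<alpha> \<beta> X P = 1\<close> and \<open>polar_form \<alpha> \<beta> X Q = 1\<close>.\<close>

definition pole :: "real \<Rightarrow> real \<Rightarrow> point \<Rightarrow> point \<Rightarrow> point" where
  "pole \<alpha> \<beta> P Q =
     (\<alpha>\<^sup>2 * (snd Q - snd P) / wedge P Q, \<beta>\<^sup>2 * (fst P - fst Q) / wedge P Q)"

lemma polar_form_pole:
  assumes "\<alpha> > 0" "\<beta> > 0" "wedge P Q \<noteq> 0"
  shows "polar_form \<alpha> \<beta> (pole \<alpha> \<beta> P Q) P = 1" "polar_form \<alpha> \<beta> (pole \<alpha> \<beta> P Q) Q = 1"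
proof -
  have "(snd Q - snd P) / wedge P Q * fst P + (fst P - fst Q) / wedge P Q * snd P = 1"
    "(snd Q - snd P) / wedge P Q * fst Q + (fst P - fst Q) / wedge P Q * snd Q = 1"
    using assms(3) unfolding times_divide_eq_left add_divide_distrib[symmetric]
    by (simp_all add: wedge_def algebra_simps)
  then show "polar_form \<alpha> \<beta> (pole \<alpha> \<beta> P Q) P = 1" "polar_form \<alpha> \<beta> (pole \<alpha> \<beta> P Q) Q = 1"
    using assms(1,2) by (simp_all add: polar_form_def pole_def)
qed

text \<open>After division by the square of the wedge, the tangency equation of the line \<open>P Q\<close> is the
  equation of the polar ellipse at the pole. A tangent of an ellipse misses its centre, whence the
  wedge does not vanish.\<close>

lemma pole_mem_ellipse:
  assumes "\<alpha> > 0" "\<beta> > 0" "c > 0" "d > 0" "P \<noteq> Q"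
    and "tangent (affine hull {P, Q}) (ellipse c d)"
  shows "wedge P Q \<noteq> 0" "pole \<alpha> \<beta> P Q \<in> ellipse (\<alpha>\<^sup>2 / c) (\<beta>\<^sup>2 / d)"
proof -
  have eq: "(wedge P Q)\<^sup>2 = c\<^sup>2 * (snd Q - snd P)\<^sup>2 + d\<^sup>2 * (fst Q - fst P)\<^sup>2"
    using assms by (simp add: tangent_ellipse_iff)
  have "fst Q \<noteq> fst P \<or> snd Q \<noteq> snd P" using assms(5) by (auto simp: prod_eq_iff)
  then have "c\<^sup>2 * (snd Q - snd P)\<^sup>2 + d\<^sup>2 * (fst Q - fst P)\<^sup>2 > 0"
    using assms(3,4) by (auto intro: add_pos_nonneg add_nonneg_pos)
  then show w: "wedge P Q \<noteq> 0" using eq by auto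
  have "c\<^sup>2 * (snd Q - snd P)\<^sup>2 / (wedge P Q)\<^sup>2 + d\<^sup>2 * (fst P - fst Q)\<^sup>2 / (wedge P Q)\<^sup>2 = 1"
    using w unfolding add_divide_distrib[symmetric] power2_commute[of "fst P"] eq[symmetric]
    by simp
  then show "pole \<alpha> \<beta> P Q \<in> ellipse (\<alpha>\<^sup>2 / c) (\<beta>\<^sup>2 / d)"
    using assms by (simp add: ellipse_def pole_def power_divide power_mult_distrib mult.commute)
qed

text \<open>The converse half of duality: Cramer's rule expresses the line \<open>P1 P2\<close> through its pole \<open>Q\<close>, and
  the equation of the ellipse at \<open>Q\<close> becomes the tangency equation.\<close>

lemma polar_line_tangent:
  assumes "\<alpha> > 0" "\<beta> > 0" "A > 0" "B > 0" "P1 \<noteq> P2" "Q \<in> ellipse A B"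
    and "polar_form \<alpha> \<beta> P1 Q = 1" "polar_form \<alpha> \<beta> P2 Q = 1"
  shows "tangent (affine hull {P1, P2}) (ellipse (\<alpha>\<^sup>2 / A) (\<beta>\<^sup>2 / B))"
proof -
  define m n where "m = fst Q / \<alpha>\<^sup>2" and "n = snd Q / \<beta>\<^sup>2"
  have "fst P1 * m + snd P1 * n = 1" "fst P2 * m + snd P2 * n = 1"
    using assms by (simp_all add: polar_form_def m_def n_def)
  then have cramer: "snd P2 - snd P1 = wedge P1 P2 * m" "fst P2 - fst P1 = - wedge P1 P2 * n"
    unfolding wedge_def by algebra+
  have "(fst Q)\<^sup>2 / A\<^sup>2 + (snd Q)\<^sup>2 / B\<^sup>2 = 1"
    using assms(6) by (cases Q) (simp add: ellipse_def)
  then have "(\<alpha>\<^sup>2 / A)\<^sup>2 * m\<^sup>2 + (\<beta>\<^sup>2 / B)\<^sup>2 * n\<^sup>2 = 1"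
    using assms(1-4) by (simp add: m_def n_def power_divide)
  then have "(wedge P1 P2)\<^sup>2 = (\<alpha>\<^sup>2 / A)\<^sup>2 * (wedge P1 P2 * m)\<^sup>2 + (\<beta>\<^sup>2 / B)\<^sup>2 * (- wedge P1 P2 * n)\<^sup>2"
    by algebra
  then show ?thesis using assms(1-5) cramer by (simp add: tangent_ellipse_iff)
qed

text \<open>Applied with \<open>(c, d) = (\<alpha>, \<beta>)\<close> this inscribes the polar triangle in the ellipse of polarity, and
  with \<open>(A, B) = (\<alpha>, \<beta>)\<close> it circumscribes it.\<close>

lemma polar_triangle:
  assumes pos: "\<alpha> > 0" "\<beta> > 0" "A > 0" "B > 0" "c > 0" "d > 0"
    and T: "T \<in> poncelet_triangles (ellipse A B) (ellipse c d)"
  obtains Q1 Q2 Q3 P1 P2 P3 where "T = {Q1, Q2, Q3}"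
    and "{P1, P2, P3} \<in> poncelet_triangles (ellipse (\<alpha>\<^sup>2 / c) (\<beta>\<^sup>2 / d)) (ellipse (\<alpha>\<^sup>2 / A) (\<beta>\<^sup>2 / B))"
    and "polar_form \<alpha> \<beta> P1 Q2 = 1" "polar_form \<alpha> \<beta> P1 Q3 = 1"
    and "polar_form \<alpha> \<beta> P2 Q1 = 1" "polar_form \<alpha> \<beta> P2 Q3 = 1"
    and "polar_form \<alpha> \<beta> P3 Q1 = 1" "polar_form \<alpha> \<beta> P3 Q2 = 1"
proof -
  have tri: "is_triangle T" and on: "T \<subseteq> ellipse A B"
    and tan: "\<And>P Q. P \<in> T \<Longrightarrow> Q \<in> T \<Longrightarrow> P \<noteq> Q \<Longrightarrow> tangent (affine hull {P, Q}) (ellipse c d)"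
    using T by (auto simp: poncelet_triangles_def ball_side_lines_iff)
  obtain Q1 Q2 Q3 where Q: "T = {Q1, Q2, Q3}" and ne: "Q1 \<noteq> Q2" "Q2 \<noteq> Q3" "Q1 \<noteq> Q3"
    using tri by (rule is_triangleE)
  define P1 P2 P3 where "P1 = pole \<alpha> \<beta> Q2 Q3" and "P2 = pole \<alpha> \<beta> Q3 Q1" and "P3 = pole \<alpha> \<beta> Q1 Q2"
  have t: "tangent (affine hull {Q2, Q3}) (ellipse c d)" "tangent (affine hull {Q3, Q1}) (ellipse c d)"
    "tangent (affine hull {Q1, Q2}) (ellipse c d)"
    using tan Q ne by auto
  have w: "wedge Q2 Q3 \<noteq> 0" "wedge Q3 Q1 \<noteq> 0" "wedge Q1 Q2 \<noteq> 0"
    using pole_mem_ellipse(1) pos t ne by metis+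
  have P_on: "{P1, P2, P3} \<subseteq> ellipse (\<alpha>\<^sup>2 / c) (\<beta>\<^sup>2 / d)"
    using pole_mem_ellipse(2) pos t ne by (auto simp: P1_def P2_def P3_def)
  have pol: "polar_form \<alpha> \<beta> P1 Q2 = 1" "polar_form \<alpha> \<beta> P1 Q3 = 1"
    "polar_form \<alpha> \<beta> P2 Q1 = 1" "polar_form \<alpha> \<beta> P2 Q3 = 1"
    "polar_form \<alpha> \<beta> P3 Q1 = 1" "polar_form \<alpha> \<beta> P3 Q2 = 1"
    using polar_form_pole pos w by (simp_all add: P1_def P2_def P3_def)
  have tri_Q: "is_triangle {Q1, Q2, Q3}" using tri Q by simp
  have P_ne: "P1 \<noteq> P2" "P2 \<noteq> P3" "P1 \<noteq> P3"
    using pol tri_Q not_triangle_of_common_polar[of \<alpha> \<beta> Q1 _ Q2 Q3] polar_form_commute by metis+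
  have "is_triangle {P1, P2, P3}"
    using is_triangle_of_ellipse_points[OF _ _ P_ne P_on] pos by simp
  moreover have "tangent (affine hull {P1, P2}) (ellipse (\<alpha>\<^sup>2 / A) (\<beta>\<^sup>2 / B))"
    "tangent (affine hull {P2, P3}) (ellipse (\<alpha>\<^sup>2 / A) (\<beta>\<^sup>2 / B))"
    "tangent (affine hull {P1, P3}) (ellipse (\<alpha>\<^sup>2 / A) (\<beta>\<^sup>2 / B))"
    using polar_line_tangent[OF pos(1-4)] P_ne pol on Q by (meson insertCI subsetD)+
  then have "\<forall>L \<in> side_lines {P1, P2, P3}. tangent L (ellipse (\<alpha>\<^sup>2 / A) (\<beta>\<^sup>2 / B))"
    unfolding ball_side_lines_iff by (auto simp: insert_commute)
  ultimately have "{P1, P2, P3} \<in> poncelet_triangles (ellipse (\<alpha>\<^sup>2 / c) (\<beta>\<^sup>2 / d)) (ellipse (\<alpha>\<^sup>2 / A) (\<beta>\<^sup>2 / B))"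
    using P_on by (simp add: poncelet_triangles_def)
  then show thesis using that Q pol by blast
qed

lemma excentral_eq_polar_triangle:
  assumes pos: "\<alpha> > 0" "\<beta> > 0" "\<alpha>\<^sub>c > 0" "\<beta>\<^sub>c > 0"
    and confocal: "\<alpha>\<^sub>c < \<alpha>" "\<alpha>\<^sup>2 - \<beta>\<^sup>2 = \<alpha>\<^sub>c\<^sup>2 - \<beta>\<^sub>c\<^sup>2"
    and P: "{P1, P2, P3} \<in> confocal_family \<alpha> \<beta> \<alpha>\<^sub>c \<beta>\<^sub>c"
    and pol: "polar_form \<alpha> \<beta> P1 Q2 = 1" "polar_form \<alpha> \<beta> P1 Q3 = 1"
      "polar_form \<alpha> \<beta> P2 Q1 = 1" "polar_form \<alpha> \<beta> P2 Q3 = 1"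
      "polar_form \<alpha> \<beta> P3 Q1 = 1" "polar_form \<alpha> \<beta> P3 Q2 = 1"
  shows "excentral_triangle {P1, P2, P3} = {Q1, Q2, Q3}"
proof -
  have tri: "is_triangle {P1, P2, P3}" and on: "{P1, P2, P3} \<subseteq> ellipse \<alpha> \<beta>"
    and tan: "\<forall>L \<in> side_lines {P1, P2, P3}. tangent L (ellipse \<alpha>\<^sub>c \<beta>\<^sub>c)"
    using P by (auto simp: confocal_family_def poncelet_triangles_def)
  have ne: "P1 \<noteq> P2" "P2 \<noteq> P3" "P1 \<noteq> P3"
    using tri by (auto simp: is_triangle_iff_wedge)
  have perm: "{P2, P3, P1} = {P1, P2, P3}" "{P3, P1, P2} = {P1, P2, P3}" by auto
  have "excenter {P1, P2, P3} Q1"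
    using pole_is_excenter[OF pos confocal ne on tan] pol by simp
  moreover have "excenter {P1, P2, P3} Q2"
    using pole_is_excenter[OF pos confocal, of P2 P3 P1 Q2] ne on tan pol
    unfolding perm by simp
  moreover have "excenter {P1, P2, P3} Q3"
    using pole_is_excenter[OF pos confocal, of P3 P1 P2 Q3] ne on tan pol
    unfolding perm by simp
  ultimately have sub: "{Q1, Q2, Q3} \<subseteq> excentral_triangle {P1, P2, P3}"
    by (simp add: excentral_triangle_def)
  have "\<not> (polar_form \<alpha> \<beta> P1 Q = 1 \<and> polar_form \<alpha> \<beta> P2 Q = 1 \<and> polar_form \<alpha> \<beta> P3 Q = 1)" for Q
    using not_triangle_of_common_polar tri by blast
  from this[of Q1] this[of Q2] pol have "Q1 \<noteq> Q2" "Q2 \<noteq> Q3" "Q1 \<noteq> Q3" by auto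
  then have "card {Q1, Q2, Q3} = 3" by simp
  then show ?thesis
    using card_seteq[OF _ sub] excentral_triangle_le_3[OF tri] by simp
qed

lemma polar_axis_involution:
  fixes x y :: real
  assumes "x > 0"
  shows "x\<^sup>2 / x = x" "x\<^sup>2 / (x\<^sup>2 / y) = y"
  using assms by (simp_all add: power2_eq_square)

text \<open>Polarity is an involution, so the excentral triangle of the polar triangle of \<open>T\<close> is \<open>T\<close> again; this
  makes the inclusion \<open>\<supseteq>\<close> hold.\<close>

theorem excentral_image_confocal_family:
  assumes pos: "\<alpha> > 0" "\<beta> > 0" "\<alpha>\<^sub>c > 0" "\<beta>\<^sub>c > 0"
    and confocal: "\<alpha>\<^sub>c < \<alpha>" "\<alpha>\<^sup>2 - \<beta>\<^sup>2 = \<alpha>\<^sub>c\<^sup>2 - \<beta>\<^sub>c\<^sup>2"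
  shows "excentral_triangle ` confocal_family \<alpha> \<beta> \<alpha>\<^sub>c \<beta>\<^sub>c =
    poncelet_triangles (ellipse (\<alpha>\<^sup>2 / \<alpha>\<^sub>c) (\<beta>\<^sup>2 / \<beta>\<^sub>c)) (ellipse \<alpha> \<beta>)"
    (is "_ = ?E")
proof (intro subset_antisym subsetI)
  fix T assume "T \<in> excentral_triangle ` confocal_family \<alpha> \<beta> \<alpha>\<^sub>c \<beta>\<^sub>c"
  then obtain T' where T': "T' \<in> confocal_family \<alpha> \<beta> \<alpha>\<^sub>c \<beta>\<^sub>c" "T = excentral_triangle T'"
    by blast
  have mem: "T' \<in> poncelet_triangles (ellipse \<alpha> \<beta>) (ellipse \<alpha>\<^sub>c \<beta>\<^sub>c)"
    using T'(1) by (simp add: confocal_family_def)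
  obtain P1 P2 P3 Q1 Q2 Q3 where P: "T' = {P1, P2, P3}"
    and Q: "{Q1, Q2, Q3} \<in> poncelet_triangles (ellipse (\<alpha>\<^sup>2 / \<alpha>\<^sub>c) (\<beta>\<^sup>2 / \<beta>\<^sub>c))
      (ellipse (\<alpha>\<^sup>2 / \<alpha>) (\<beta>\<^sup>2 / \<beta>))"
    and pol: "polar_form \<alpha> \<beta> Q1 P2 = 1" "polar_form \<alpha> \<beta> Q1 P3 = 1"
      "polar_form \<alpha> \<beta> Q2 P1 = 1" "polar_form \<alpha> \<beta> Q2 P3 = 1"
      "polar_form \<alpha> \<beta> Q3 P1 = 1" "polar_form \<alpha> \<beta> Q3 P2 = 1"
    by (rule polar_triangle[OF pos(1,2) pos mem])
  have "excentral_triangle T' = {Q1, Q2, Q3}"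
    unfolding P using pol T'(1)[unfolded P]
    by (intro excentral_eq_polar_triangle[OF pos confocal]) (simp_all only: polar_form_commute)
  with Q show "T \<in> ?E" using T'(2) pos by (simp add: polar_axis_involution)
next
  fix T assume T: "T \<in> ?E"
  have pos': "\<alpha>\<^sup>2 / \<alpha>\<^sub>c > 0" "\<beta>\<^sup>2 / \<beta>\<^sub>c > 0" using pos by simp_all
  obtain Q1 Q2 Q3 P1 P2 P3 where Q: "T = {Q1, Q2, Q3}"
    and P: "{P1, P2, P3} \<in> poncelet_triangles (ellipse (\<alpha>\<^sup>2 / \<alpha>) (\<beta>\<^sup>2 / \<beta>))
      (ellipse (\<alpha>\<^sup>2 / (\<alpha>\<^sup>2 / \<alpha>\<^sub>c)) (\<beta>\<^sup>2 / (\<beta>\<^sup>2 / \<beta>\<^sub>c)))"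
    and pol: "polar_form \<alpha> \<beta> P1 Q2 = 1" "polar_form \<alpha> \<beta> P1 Q3 = 1"
      "polar_form \<alpha> \<beta> P2 Q1 = 1" "polar_form \<alpha> \<beta> P2 Q3 = 1"
      "polar_form \<alpha> \<beta> P3 Q1 = 1" "polar_form \<alpha> \<beta> P3 Q2 = 1"
    by (rule polar_triangle[OF pos(1,2) pos' pos(1,2) T])
  have mem: "{P1, P2, P3} \<in> confocal_family \<alpha> \<beta> \<alpha>\<^sub>c \<beta>\<^sub>c"
    using P pos by (simp only: confocal_family_def polar_axis_involution)
  then have "T = excentral_triangle {P1, P2, P3}"
    unfolding Q using excentral_eq_polar_triangle[OF pos confocal mem pol] by simp
  with mem show "T \<in> excentral_triangle ` confocal_family \<alpha> \<beta> \<alpha>\<^sub>c \<beta>\<^sub>c" by blast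
qed

section \<open>Scaling the circumcircle family\<close>

lemma x_scaling_poncelet_triangles_subset:
  assumes "m > 0" "A > 0" "B > 0" "c > 0" "d > 0"
    and T: "T \<in> poncelet_triangles (ellipse A B) (ellipse c d)"
  shows "scaling (1, 0) m ` T \<in> poncelet_triangles (ellipse (m * A) B) (ellipse (m * c) d)"
proof -
  define f where "f = scaling (1, 0) m"
  have f: "f p = (m * fst p, snd p)" for p
    by (cases p) (simp add: f_def scaling_x_axis)
  have tri: "is_triangle T" and on: "T \<subseteq> ellipse A B"
    and tan: "\<And>P Q. P \<in> T \<Longrightarrow> Q \<in> T \<Longrightarrow> P \<noteq> Q \<Longrightarrow> tangent (affine hull {P, Q}) (ellipse c d)"
    using T by (auto simp: poncelet_triangles_def ball_side_lines_iff)
  obtain P Q R where PQR: "T = {P, Q, R}"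
    using tri by (rule is_triangleE)
  have "wedge (f Q - f P) (f R - f P) = m * wedge (Q - P) (R - P)"
    by (simp add: f wedge_def algebra_simps)
  then have "is_triangle (f ` T)"
    using tri assms(1) by (simp add: PQR is_triangle_iff_wedge)
  moreover have "f P \<in> ellipse (m * A) B" if "P \<in> T" for P
    using on that assms(1) by (cases P) (auto simp: f ellipse_def power_mult_distrib)
  moreover have "tangent (affine hull {f P, f Q}) (ellipse (m * c) d)"
    if "P \<in> T" "Q \<in> T" "f P \<noteq> f Q" for P Q
  proof -
    have ne: "P \<noteq> Q" using that(3) by auto
    have "wedge (f P) (f Q) = m * wedge P Q" by (simp add: f wedge_def algebra_simps)
    moreover have "(wedge P Q)\<^sup>2 = c\<^sup>2 * (snd Q - snd P)\<^sup>2 + d\<^sup>2 * (fst Q - fst P)\<^sup>2"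
      using tan[OF that(1,2) ne] ne assms by (simp add: tangent_ellipse_iff)
    ultimately have "(wedge (f P) (f Q))\<^sup>2 = (m * c)\<^sup>2 * (snd Q - snd P)\<^sup>2 + d\<^sup>2 * (m * fst Q - m * fst P)\<^sup>2"
      by (simp add: power_mult_distrib right_diff_distrib[symmetric]) (simp add: algebra_simps)
    then show ?thesis using assms that(3) by (simp add: tangent_ellipse_iff) (simp add: f)
  qed
  ultimately show ?thesis
    unfolding poncelet_triangles_def ball_side_lines_iff f_def[symmetric] by auto
qed

lemma x_scaling_poncelet_triangles:
  assumes "m > 0" "A > 0" "B > 0" "c > 0" "d > 0"
  shows "(\<lambda>T. scaling (1, 0) m ` T) ` poncelet_triangles (ellipse A B) (ellipse c d) =
    poncelet_triangles (ellipse (m * A) B) (ellipse (m * c) d)"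
proof (intro subset_antisym subsetI)
  fix T assume "T \<in> poncelet_triangles (ellipse (m * A) B) (ellipse (m * c) d)"
  then have "scaling (1, 0) (1 / m) ` T \<in> poncelet_triangles (ellipse A B) (ellipse c d)"
    using x_scaling_poncelet_triangles_subset[of "1 / m" "m * A" B "m * c" d T] assms by simp
  moreover have "scaling (1, 0) m (scaling (1, 0) (1 / m) p) = p" for p
    using assms(1) by (cases p) (simp add: scaling_x_axis)
  then have "T = scaling (1, 0) m ` scaling (1, 0) (1 / m) ` T"
    by (simp add: image_image)
  ultimately show "T \<in> (\<lambda>T. scaling (1, 0) m ` T) ` poncelet_triangles (ellipse A B) (ellipse c d)"
    by blast
qed (use x_scaling_poncelet_triangles_subset assms in auto)

lemma circumcircle_family_eq:
  assumes "a > 0" "b > 0"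
  shows "circumcircle_family a b = poncelet_triangles (ellipse (a + b) (a + b)) (ellipse a b)"
  using assms by (simp add: circumcircle_family_def sphere_eq_ellipse)

lemma isosceles_mem_circumcircle_family:
  assumes "a > 0" "b > 0" "q > 0" "q\<^sup>2 = b * (2 * a + b)"
  shows "{(a + b, 0), (- a, q), (- a, - q)} \<in> circumcircle_family a b"
proof -
  have q: "q\<^sup>2 + a\<^sup>2 = (a + b)\<^sup>2" using assms(4) by algebra
  have on: "{(a + b, 0), (- a, q), (- a, - q)} \<subseteq> ellipse (a + b) (a + b)"
    using assms q by (simp add: ellipse_def add_divide_distrib[symmetric] add.commute)
  have ne: "(a + b, 0) \<noteq> (- a, q)" "(- a, q) \<noteq> (- a, - q)" "(a + b, 0) \<noteq> (- a, - q)"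
    using assms by auto
  have tri: "is_triangle {(a + b, 0), (- a, q), (- a, - q)}"
    using is_triangle_of_ellipse_points[OF _ _ ne on] assms by simp
  have "((a + b) * q)\<^sup>2 = a\<^sup>2 * q\<^sup>2 + b\<^sup>2 * (2 * a + b)\<^sup>2"
    using assms(4) by algebra
  then have "tangent (affine hull {(a + b, 0), (- a, q)}) (ellipse a b)"
    "tangent (affine hull {(a + b, 0), (- a, - q)}) (ellipse a b)"
    "tangent (affine hull {(- a, q), (- a, - q)}) (ellipse a b)"
    using tangent_ellipse_iff[OF assms(1,2)] ne
    by (simp_all add: wedge_def) (simp_all add: power2_eq_square algebra_simps)
  then have "\<forall>L \<in> side_lines {(a + b, 0), (- a, q), (- a, - q)}. tangent L (ellipse a b)"
    unfolding ball_side_lines_iff by (auto simp: insert_commute)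
  with on tri show ?thesis
    using assms by (simp add: circumcircle_family_eq poncelet_triangles_def)
qed

text \<open>The positive root \<open>m\<close> of \<open>m\<^sup>2 a (2a + b) = b (a + 2b)\<close>.\<close>

definition excentral_ratio :: "real \<Rightarrow> real \<Rightarrow> real" where
  "excentral_ratio a b = sqrt ((2 * b\<^sup>2 + a * b) / (2 * a\<^sup>2 + a * b))"

lemma excentral_ratio:
  assumes "a > 0" "b > 0"
  shows "excentral_ratio a b > 0"
    and "(excentral_ratio a b)\<^sup>2 * (a * (2 * a + b)) = b * (a + 2 * b)"
proof -
  have "a * (2 * a + b) = 2 * a\<^sup>2 + a * b" "b * (a + 2 * b) = 2 * b\<^sup>2 + a * b"
    by (simp_all add: power2_eq_square algebra_simps)
  moreover have "2 * a\<^sup>2 + a * b > 0" "2 * b\<^sup>2 + a * b > 0"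
    using assms by (simp_all add: add_pos_pos)
  ultimately show "excentral_ratio a b > 0"
    "(excentral_ratio a b)\<^sup>2 * (a * (2 * a + b)) = b * (a + 2 * b)"
    by (simp_all add: excentral_ratio_def)
qed

text \<open>The scaled family has inner semi-axes \<open>m a, b\<close> and outer semi-axes \<open>m (a + b), a + b\<close>, so the
  confocal caustic has to be the polar of the outer ellipse.\<close>

lemma x_scaling_sends_to_excentral:
  assumes ab: "a > 0" "b > 0"
  shows "sends_to_excentral (scaling (1, 0) (excentral_ratio a b)) a b"
proof -
  define m where "m = excentral_ratio a b"
  have m: "m > 0" "m\<^sup>2 * (a * (2 * a + b)) = b * (a + 2 * b)"
    using excentral_ratio[OF ab] by (simp_all add: m_def)
  define \<alpha>\<^sub>c \<beta>\<^sub>c where "\<alpha>\<^sub>c = m * a * (a / (a + b))" and "\<beta>\<^sub>c = b * (b / (a + b))"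
  have lt: "\<alpha>\<^sub>c < m * a" "\<beta>\<^sub>c < b"
    using ab m mult_strict_left_mono[of "a / (a + b)" 1 "m * a"]
      mult_strict_left_mono[of "b / (a + b)" 1 b] by (simp_all add: \<alpha>\<^sub>c_def \<beta>\<^sub>c_def)
  have pos: "m * a > 0" "\<alpha>\<^sub>c > 0" "\<beta>\<^sub>c > 0"
    using ab m by (simp_all add: \<alpha>\<^sub>c_def \<beta>\<^sub>c_def)
  have "((m * a)\<^sup>2 - b\<^sup>2) * (a + b)\<^sup>2 = (m * a * a)\<^sup>2 - (b * b)\<^sup>2"
    using m(2) by algebra
  then have "(m * a)\<^sup>2 - b\<^sup>2 = ((m * a * a)\<^sup>2 - (b * b)\<^sup>2) / (a + b)\<^sup>2"
    using ab by (simp add: nonzero_eq_divide_eq)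
  then have confocal: "(m * a)\<^sup>2 - b\<^sup>2 = \<alpha>\<^sub>c\<^sup>2 - \<beta>\<^sub>c\<^sup>2"
    by (simp add: \<alpha>\<^sub>c_def \<beta>\<^sub>c_def power_divide diff_divide_distrib)
  have axes: "(m * a)\<^sup>2 / \<alpha>\<^sub>c = m * (a + b)" "b\<^sup>2 / \<beta>\<^sub>c = a + b"
    using ab m by (simp_all add: \<alpha>\<^sub>c_def \<beta>\<^sub>c_def power2_eq_square)
  have image: "(\<lambda>T. scaling (1, 0) m ` T) ` circumcircle_family a b =
      excentral_triangle ` confocal_family (m * a) b \<alpha>\<^sub>c \<beta>\<^sub>c"
    using excentral_image_confocal_family[OF pos(1) ab(2) pos(2,3) lt(1) confocal]
      x_scaling_poncelet_triangles[of m "a + b" "a + b" a b] ab m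
    by (simp add: axes circumcircle_family_eq)
  have "circumcircle_family a b \<noteq> {}"
    using isosceles_mem_circumcircle_family[of a b "sqrt (b * (2 * a + b))"] ab by auto
  then have "confocal_family (m * a) b \<alpha>\<^sub>c \<beta>\<^sub>c \<noteq> {}" using image by auto
  then have "confocal_pair (m * a) b \<alpha>\<^sub>c \<beta>\<^sub>c"
    using pos lt confocal ab by (simp add: confocal_pair_def confocal_family_def)
  with image show ?thesis
    unfolding sends_to_excentral_def is_excentral_family_def m_def by blast
qed

text \<open>The scaling is given by a positive definite symmetric matrix \<open>S\<close>. The side lines of one triangle
  show that \<open>S\<close> maps the caustic to the inner ellipse of the excentral family; as that ellipse is
  axis-aligned, \<open>S\<close> is diagonal.\<close>

lemma scaling_sends_to_excentral_unique:
  assumes ab: "a > 0" "b > 0" and u: "norm u = 1" and l: "l > 0"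
    and sends: "sends_to_excentral (scaling u l) a b"
  shows "\<exists>k>0. \<forall>p. scaling u l p = k *\<^sub>R scaling (1, 0) (excentral_ratio a b) p"
proof -
  define m where "m = excentral_ratio a b"
  have m: "m > 0" "m\<^sup>2 * (a * (2 * a + b)) = b * (a + 2 * b)"
    using excentral_ratio[OF ab] by (simp_all add: m_def)
  obtain c s where u_eq: "u = (c, s)" by (cases u)
  have cs: "c\<^sup>2 + s\<^sup>2 = 1" using u by (simp add: u_eq norm_Pair)
  define s11 s12 s22 where "s11 = s\<^sup>2 + l * c\<^sup>2" and "s12 = (l - 1) * c * s" and "s22 = c\<^sup>2 + l * s\<^sup>2"
  define S where "S p = (s11 * fst p + s12 * snd p, s12 * fst p + s22 * snd p)" for p :: point
  have s_diag: "s11 = 1 + (l - 1) * c\<^sup>2" "s22 = 1 + (l - 1) * s\<^sup>2"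
    using cs unfolding s11_def s22_def by algebra+
  have S: "scaling u l p = S p" for p
    by (cases p) (simp add: scaling_def u_eq S_def s_diag s12_def power2_eq_square algebra_simps)
  have "c \<noteq> 0 \<or> s \<noteq> 0" using cs by auto
  then have s_pos: "s11 > 0" "s22 > 0"
    using l by (auto simp: s11_def s22_def intro: add_pos_nonneg add_nonneg_pos)
  have det: "s11 * s22 - s12\<^sup>2 = l"
  proof -
    have "s11 * s22 - s12\<^sup>2 = l * (c\<^sup>2 + s\<^sup>2)\<^sup>2"
      unfolding s11_def s22_def s12_def by algebra
    then show ?thesis by (simp add: cs)
  qed
  have wedge_S: "wedge (S p) (S p') = l * wedge p p'" for p p'
    unfolding wedge_def S_def det[symmetric] by (simp add: power2_eq_square algebra_simps)

  obtain \<alpha> \<beta> \<alpha>\<^sub>c \<beta>\<^sub>c where pair: "confocal_pair \<alpha> \<beta> \<alpha>\<^sub>c \<beta>\<^sub>c"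
    and image: "(\<lambda>T. scaling u l ` T) ` circumcircle_family a b =
      excentral_triangle ` confocal_family \<alpha> \<beta> \<alpha>\<^sub>c \<beta>\<^sub>c"
    using sends unfolding sends_to_excentral_def is_excentral_family_def
    by (elim exE conjE) (rule that)
  have pos: "\<alpha> > 0" "\<beta> > 0" "\<alpha>\<^sub>c > 0" "\<beta>\<^sub>c > 0"
    and confocal: "\<alpha>\<^sub>c < \<alpha>" "\<alpha>\<^sup>2 - \<beta>\<^sup>2 = \<alpha>\<^sub>c\<^sup>2 - \<beta>\<^sub>c\<^sup>2"
    using pair by (auto simp: confocal_pair_def)

  define q where "q = sqrt (b * (2 * a + b))"
  have q: "q > 0" "q\<^sup>2 = b * (2 * a + b)" using ab by (simp_all add: q_def)
  define v0 v1 v2 where "v0 = (a + b, 0::real)" and "v1 = (- a, q)" and "v2 = (- a, - q)"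
  have "(`) (scaling u l) {v0, v1, v2} \<in> poncelet_triangles (ellipse (\<alpha>\<^sup>2 / \<alpha>\<^sub>c) (\<beta>\<^sup>2 / \<beta>\<^sub>c)) (ellipse \<alpha> \<beta>)"
    using imageI[OF isosceles_mem_circumcircle_family[OF ab q], of "(`) (scaling u l)"]
    unfolding image excentral_image_confocal_family[OF pos confocal] v0_def v1_def v2_def .
  then have on: "S v0 \<in> ellipse (\<alpha>\<^sup>2 / \<alpha>\<^sub>c) (\<beta>\<^sup>2 / \<beta>\<^sub>c)" "S v1 \<in> ellipse (\<alpha>\<^sup>2 / \<alpha>\<^sub>c) (\<beta>\<^sup>2 / \<beta>\<^sub>c)"
    and tan: "\<And>p p'. p \<in> {v0, v1, v2} \<Longrightarrow> p' \<in> {v0, v1, v2} \<Longrightarrow> S p \<noteq> S p' \<Longrightarrow>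
      tangent (affine hull {S p, S p'}) (ellipse \<alpha> \<beta>)"
    by (auto simp: poncelet_triangles_def ball_side_lines_iff S)
  have tan_eq: "(l * wedge p p')\<^sup>2 =
      \<alpha>\<^sup>2 * (snd (S p') - snd (S p))\<^sup>2 + \<beta>\<^sup>2 * (fst (S p') - fst (S p))\<^sup>2"
    if "p \<in> {v0, v1, v2}" "p' \<in> {v0, v1, v2}" "wedge p p' \<noteq> 0" for p p'
  proof -
    have "S p \<noteq> S p'" using wedge_S[of p p'] that(3) l by auto
    with tan[OF that(1,2) this] show ?thesis
      using tangent_ellipse_iff[OF pos(1,2), of "S p" "S p'"] wedge_S[of p p'] by simp
  qed
  \<comment> \<open>three tangent lines give three linear equations for \<open>\<alpha>\<^sup>2\<close>, \<open>\<beta>\<^sup>2\<close>, which also force \<open>s12 = 0\<close>\<close>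
  have w: "wedge v1 v2 = 2 * a * q" "wedge v0 v1 = (a + b) * q" "wedge v0 v2 = - ((a + b) * q)"
    by (simp_all add: wedge_def v0_def v1_def v2_def)
  have w_ne: "wedge v1 v2 \<noteq> 0" "wedge v0 v1 \<noteq> 0" "wedge v0 v2 \<noteq> 0"
    unfolding w using ab q(1) by simp_all
  have S_v: "S v0 = (s11 * (a + b), s12 * (a + b))" "S v1 = (s12 * q - s11 * a, s22 * q - s12 * a)"
    "S v2 = (- s12 * q - s11 * a, - s22 * q - s12 * a)"
    by (simp_all add: S_def v0_def v1_def v2_def)
  have "(2 * q)\<^sup>2 * (l\<^sup>2 * a\<^sup>2) = (2 * q)\<^sup>2 * (\<alpha>\<^sup>2 * s22\<^sup>2 + \<beta>\<^sup>2 * s12\<^sup>2)"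
    using tan_eq[OF _ _ w_ne(1)] unfolding w S_v fst_conv snd_conv by simp algebra
  then have side12: "l\<^sup>2 * a\<^sup>2 = \<alpha>\<^sup>2 * s22\<^sup>2 + \<beta>\<^sup>2 * s12\<^sup>2" using q(1) by simp
  have side01: "(l * ((a + b) * q))\<^sup>2 =
      \<alpha>\<^sup>2 * (s22 * q - s12 * a - s12 * (a + b))\<^sup>2 + \<beta>\<^sup>2 * (s12 * q - s11 * a - s11 * (a + b))\<^sup>2"
    using tan_eq[OF _ _ w_ne(2)] unfolding w S_v fst_conv snd_conv by simp
  have side02: "(l * - ((a + b) * q))\<^sup>2 =
      \<alpha>\<^sup>2 * (- s22 * q - s12 * a - s12 * (a + b))\<^sup>2 + \<beta>\<^sup>2 * (- s12 * q - s11 * a - s11 * (a + b))\<^sup>2"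
    using tan_eq[OF _ _ w_ne(3)] unfolding w S_v fst_conv snd_conv by simp
  have "4 * q * (2 * a + b) * (s12 * (\<alpha>\<^sup>2 * s22 + \<beta>\<^sup>2 * s11)) = 0"
    using side01 side02 by algebra
  moreover have "\<alpha>\<^sup>2 * s22 + \<beta>\<^sup>2 * s11 > 0" using pos s_pos by (simp add: add_pos_pos)
  ultimately have s12: "s12 = 0" using q(1) ab by simp
  have l_eq: "l = s11 * s22" using det s12 by simp
  have "(s11 * a)\<^sup>2 * s22\<^sup>2 = \<alpha>\<^sup>2 * s22\<^sup>2" using side12 by (simp add: s12 l_eq power_mult_distrib mult_ac)
  then have \<alpha>: "\<alpha> = s11 * a"
    using s_pos pos ab by (simp add: power2_eq_iff_nonneg)
  have "(s11 * (2 * a + b))\<^sup>2 * \<beta>\<^sup>2 = (s11 * (2 * a + b))\<^sup>2 * (s22 * b)\<^sup>2"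
    using side01 q(2) unfolding s12 l_eq \<alpha> by algebra
  then have \<beta>: "\<beta> = s22 * b"
    using s_pos pos ab by (simp add: power2_eq_iff_nonneg)
  \<comment> \<open>two vertices on the outer ellipse determine the semi-axes of the confocal caustic\<close>
  have "(s11 * (a + b))\<^sup>2 = (\<alpha>\<^sup>2 / \<alpha>\<^sub>c)\<^sup>2"
    using on(1) pos by (simp add: ellipse_def S_def v0_def s12)
  then have outer_axis: "s11 * (a + b) = \<alpha>\<^sup>2 / \<alpha>\<^sub>c"
    using s_pos pos ab by (simp add: power2_eq_iff_nonneg)
  then have "s11 * (a + b) * \<alpha>\<^sub>c = \<alpha>\<^sup>2"
    using pos by (simp add: nonzero_eq_divide_eq)
  then have "s11 * (\<alpha>\<^sub>c * (a + b)) = s11 * (s11 * a\<^sup>2)" unfolding \<alpha> by algebra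
  then have \<alpha>\<^sub>c: "\<alpha>\<^sub>c * (a + b) = s11 * a\<^sup>2" using s_pos by simp
  have "(s11 * a)\<^sup>2 / (\<alpha>\<^sup>2 / \<alpha>\<^sub>c)\<^sup>2 + (s22 * q)\<^sup>2 / (\<beta>\<^sup>2 / \<beta>\<^sub>c)\<^sup>2 = 1"
    using on(2) by (simp add: ellipse_def S_def v1_def s12)
  moreover have "(s11 * a)\<^sup>2 / (\<alpha>\<^sup>2 / \<alpha>\<^sub>c)\<^sup>2 = a\<^sup>2 / (a + b)\<^sup>2"
    using s_pos outer_axis[symmetric] by (simp add: power_mult_distrib)
  moreover have "(s22 * q)\<^sup>2 / (\<beta>\<^sup>2 / \<beta>\<^sub>c)\<^sup>2 = q\<^sup>2 * \<beta>\<^sub>c\<^sup>2 / (s22\<^sup>2 * b ^ 4)"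
    using s_pos ab by (simp add: \<beta> power_mult_distrib power_divide field_simps eval_nat_numeral)
  ultimately have "a\<^sup>2 / (a + b)\<^sup>2 + q\<^sup>2 * \<beta>\<^sub>c\<^sup>2 / (s22\<^sup>2 * b ^ 4) = 1" by simp
  then have "a\<^sup>2 * (s22\<^sup>2 * b ^ 4) + q\<^sup>2 * \<beta>\<^sub>c\<^sup>2 * (a + b)\<^sup>2 = (a + b)\<^sup>2 * (s22\<^sup>2 * b ^ 4)"
    using s_pos ab by (simp add: add_frac_eq divide_eq_eq)
  then have "q\<^sup>2 * (\<beta>\<^sub>c * (a + b))\<^sup>2 = q\<^sup>2 * (s22 * b\<^sup>2)\<^sup>2"
    using q(2) by algebra
  then have \<beta>\<^sub>c: "(\<beta>\<^sub>c * (a + b))\<^sup>2 = (s22 * b\<^sup>2)\<^sup>2" using q(1) by simp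
  have "a * b * (s11\<^sup>2 * (a * (2 * a + b))) = a * b * (s22\<^sup>2 * (b * (a + 2 * b)))"
    using confocal(2) \<alpha>\<^sub>c \<beta>\<^sub>c unfolding \<alpha> \<beta> by algebra
  then have "s11\<^sup>2 * (a * (2 * a + b)) = s22\<^sup>2 * (m\<^sup>2 * (a * (2 * a + b)))"
    using ab by (simp add: m(2))
  then have "s11\<^sup>2 = (s22 * m)\<^sup>2" using ab by (simp add: power_mult_distrib)
  then have "s11 = s22 * m" using s_pos m(1) by (simp add: power2_eq_iff_nonneg)
  then have "scaling u l p = s22 *\<^sub>R scaling (1, 0) m p" for p
    unfolding S by (cases p) (simp add: S_def s12 scaling_x_axis)
  with s_pos(2) show ?thesis unfolding m_def by blast
qed

theorem lemma2:
  fixes a b s' :: real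
  assumes "a \<ge> b" and "b > 0"
  defines "s' \<equiv> sqrt ((2 * b\<^sup>2 + a * b) / (2 * a\<^sup>2 + a * b))"
  shows "sends_to_excentral (scaling (1, 0) s') a b \<and>
    (\<forall>l>0. sends_to_excentral (scaling (1, 0) l) a b \<longrightarrow> l = s') \<and>
    (\<forall>u l. norm u = 1 \<and> l > 0 \<and> sends_to_excentral (scaling u l) a b \<longrightarrow>
       (\<exists>k>0. \<forall>p. scaling u l p = k *\<^sub>R scaling (1, 0) s' p))"
proof -
  have ab: "a > 0" "b > 0" using assms(1,2) by auto
  have s': "s' = excentral_ratio a b" by (simp add: s'_def excentral_ratio_def)
  have "l = s'" if l: "l > 0" "sends_to_excentral (scaling (1, 0) l) a b" for l
  proof -
    have "norm (1 :: real, 0 :: real) = 1" by (simp add: norm_Pair)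
    then obtain k where k: "\<forall>p. scaling (1, 0) l p = k *\<^sub>R scaling (1, 0) s' p"
      using scaling_sends_to_excentral_unique[OF ab _ l] unfolding s' by blast
    \<comment> \<open>evaluating at \<open>(0, 1)\<close> gives \<open>k = 1\<close>, and then at \<open>(1, 0)\<close> gives \<open>l = s'\<close>\<close>
    show ?thesis using spec[OF k, of "(0, 1)"] spec[OF k, of "(1, 0)"] by (simp add: scaling_x_axis)
  qed
  then show ?thesis
    using x_scaling_sends_to_excentral[OF ab] scaling_sends_to_excentral_unique[OF ab]
    unfolding s' by blast
qed

end
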